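(* For any $k\in\mathbb{N}$ and any $u\in\mathbb{D}'$, $$\mathcal{F}_k(1;u,u)=-\frac{1}{1+k}\log^{1+k}(1-u).$$
   Context: $\mathbb{D}'=\{z\in\mathbb{C}:0<|z|\le1,\ z\ne1\}$. For $\operatorname{Re}(z)>0$, $k\in\mathbb{N}$ (positive integers), $u\in\mathbb{C}\setminus((1,\infty)\cup\{0\})$ and $v\in\mathbb{C}\setminus([1,\infty)\cup\{0\})$, $$\mathcal{F}_k(z;u,v)=\int_0^1\frac{\log^k(1-ut^z)}{v^{-1}-t}\,dt,$$ where $\log$ is the complex logarithm and $\log^k(x)=(\log x)^k$. *)

theory Defs
  imports "HOL-Complex_Analysis.Complex_Analysis"
begin

definition punctured_disc :: "complex set" where
  "punctured_disc = {z. 0 < norm z \<and> norm z \<le> 1 \<and> z \<noteq> 1}"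

(* F k z u v is meant for k > 0, Re z > 0, u outside (1,\<infinity>) and {0}, and v outside [1,\<infinity>) and {0};
   outside this range its value carries no meaning. Ln is the principal branch of the
   complex logarithm, and the integral is the Lebesgue integral over [0,1]. *)
definition F :: "nat \<Rightarrow> complex \<Rightarrow> complex \<Rightarrow> complex \<Rightarrow> complex" where
  "F k z u v =
     (LINT t:{0..1::real}|lborel.
        (Ln (1 - u * (complex_of_real t powr z))) ^ k / (inverse v - complex_of_real t))"

end

theory Submission
  imports Defs
begin

text \<open>
  For \<open>z = 1\<close> and \<open>v = u\<close> the denominator is the argument of the logarithm up to a factor:
  \<open>1 / (inverse u - t) = u / (1 - u t)\<close>, which is minus the logarithmic derivative of
  \<open>1 - u t\<close>. Hence the integrand is the derivative of \<open>- Ln (1 - u t) ^ (k + 1) / (k + 1)\<close>,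
  and the fundamental theorem of calculus gives the value, the contribution of \<open>t = 0\<close> being
  \<open>Ln 1 = 0\<close>. This is legitimate with the principal branch because the segment from \<open>1\<close> to
  \<open>1 - u\<close> stays in the open right half-plane (lemma \<open>Re_one_minus_segment_pos\<close>), which
  includes the end point \<open>t = 1\<close>: there is no singularity to integrate over, even when
  \<open>norm u = 1\<close>.
\<close>

text \<open>
  Since \<open>Re u \<le> norm u \<le> 1\<close>, \<open>Re (1 - u t)\<close> fails to be positive only if \<open>t = Re u = 1\<close>, and
  the only point of the closed unit disc with real part \<open>1\<close> is the excluded point \<open>1\<close>.
\<close>

lemma Re_one_minus_segment_pos:
  fixes u :: complex and t :: real
  assumes "norm u \<le> 1" "u \<noteq> 1" "0 \<le> t" "t \<le> 1"
  shows "Re (1 - u * of_real t) > 0"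
proof -
  have "Re u < 1"
  proof (rule ccontr)
    assume "\<not> Re u < 1"
    with complex_Re_le_cmod[of u] assms(1) have re: "Re u = 1" and n: "norm u = 1"
      by linarith+
    have "Im u = 0"
      using cmod_power2[of u] re n by simp
    with re have "u = 1"
      by (simp add: complex_eq_iff)
    with assms(2) show False ..
  qed
  have "Re u * t < 1"
  proof (cases "Re u \<le> 0")
    case True
    then have "Re u * t \<le> 0"
      using assms(3) by (simp add: mult_nonpos_nonneg)
    then show ?thesis by linarith
  next
    case False
    then have "Re u * t \<le> Re u * 1"
      using assms(4) by (intro mult_left_mono) auto
    with \<open>Re u < 1\<close> show ?thesis by linarith
  qed
  then show ?thesis by simp
qed

lemma has_vector_derivative_Ln_power_segment:
  fixes u :: complex and t :: real
  assumes "u \<noteq> 0" "1 - u * of_real t \<notin> \<real>\<^sub>\<le>\<^sub>0"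
  shows "((\<lambda>s. - (1 / of_nat (1 + k)) * Ln (1 - u * of_real s) ^ (1 + k)) has_vector_derivative
           Ln (1 - u * of_real t) ^ k / (inverse u - of_real t)) (at t within S)"
proof -
  have nz: "1 - u * of_real t \<noteq> 0"
    using assms(2) by auto
  have denom: "inverse u - of_real t = (1 - u * of_real t) / u"
    using assms(1) by (simp add: field_simps)
  have c: "- (1 / of_nat (1 + k)) * (of_nat (1 + k) * (- u / w * L)) = L / (w / u)"
    if "w \<noteq> 0" for L w :: complex
    using that assms(1) of_nat_neq_0[of k, where ?'a = complex]
    by (simp add: field_simps del: of_nat_Suc of_nat_add)
  have "((\<lambda>s. Ln (1 - u * s)) has_field_derivative - u / (1 - u * of_real t)) (at (of_real t))"
    using assms(2) by (auto intro!: derivative_eq_intros simp: divide_inverse)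
  from DERIV_cmult[OF DERIV_power[OF this, of "1 + k"], of "- (1 / of_nat (1 + k))"]
  have "((\<lambda>s. - (1 / of_nat (1 + k)) * Ln (1 - u * s) ^ (1 + k)) has_field_derivative
           Ln (1 - u * of_real t) ^ k / (inverse u - of_real t)) (at (of_real t))"
    by (rule DERIV_cong) (simp only: c[OF nz] denom One_nat_def[symmetric] diff_add_inverse)
  then show ?thesis
    using has_vector_derivative_real_field has_vector_derivative_at_within by blast
qed

theorem theorem2p15:
  fixes k :: nat and u :: complex
  assumes "k > 0" and "u \<in> punctured_disc"
  shows "F k 1 u u = - (1 / of_nat (1 + k)) * (Ln (1 - u)) ^ (1 + k)"
proof -
  have u: "u \<noteq> 0" "norm u \<le> 1" "u \<noteq> 1"
    using assms(2) by (auto simp: punctured_disc_def)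
  define f where "f = (\<lambda>t::real. Ln (1 - u * of_real t) ^ k / (inverse u - of_real t))"
  define G where "G = (\<lambda>t::real. - (1 / of_nat (1 + k)) * Ln (1 - u * of_real t) ^ (1 + k))"
  have slit: "1 - u * of_real t \<notin> \<real>\<^sub>\<le>\<^sub>0" if "t \<in> {0..1}" for t :: real
    using Re_one_minus_segment_pos[OF u(2,3)] that
    by (auto simp: complex_nonpos_Reals_iff not_le)
  have denom: "inverse u - of_real t \<noteq> 0" if "t \<in> {0..1}" for t :: real
  proof
    assume "inverse u - of_real t = 0"
    then have "1 - u * of_real t = 0"
      using u(1) by (simp add: field_simps)
    with slit[OF that] show False by simp
  qed
  have cont: "continuous_on {0..1} f"
    unfolding f_def using slit denom by (intro continuous_intros) auto
  have deriv: "(G has_vector_derivative f t) (at t within {0..1})" if "0 \<le> t" "t \<le> 1" for t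
    unfolding f_def G_def
    by (rule has_vector_derivative_Ln_power_segment) (use u slit that in auto)
  have "F k 1 u u = (LINT t:{0..1}|lborel. f t)"
    unfolding F_def f_def by (intro set_lebesgue_integral_cong) auto
  also have "\<dots> = G 1 - G 0"
    unfolding set_lebesgue_integral_def
    by (rule integral_FTC_atLeastAtMost) (use deriv cont in auto)
  also have "\<dots> = - (1 / of_nat (1 + k)) * (Ln (1 - u)) ^ (1 + k)"
    by (simp add: G_def)
  finally show ?thesis .
qed

end
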